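(* Let $m\ge 1$ be an integer and let $a\in\mathbb{C}$ with $\operatorname{Re}(a)>(m-1)/2$. Define the multivariate gamma function by $$\Gamma_m[a]=\int_{A>0}\exp(-\operatorname{tr}A)\,(\det A)^{a-(m+1)/2}\,(dA),$$ where the integral is over the space of real symmetric positive definite $m\times m$ matrices $A$. Then $$\Gamma_m[a]=\pi^{m(m-1)/4}\prod_{i=1}^{m}\Gamma\!\left[a-\tfrac{i-1}{2}\right]=\pi^{m(m-1)/4}\prod_{i=1}^{m}\Gamma\!\left[a-\tfrac{m-i}{2}\right].$$
   Context: $\Gamma[\cdot]$ is the usual (Euler) gamma function. For a symmetric matrix variable $A=(a_{ij})$, $(dA)=\prod_{i\le j}da_{ij}$ is Lebesgue measure on the $m(m+1)/2$ distinct entries, and $A>0$ means that $A$ is positive definite. *)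

theory Defs
  imports "HOL-Analysis.Analysis" "Jordan_Normal_Form.Determinant"
begin

text \<open>
  Matrices and determinants are those of \<^theory>\<open>Jordan_Normal_Form.Matrix\<close> and
  \<^theory>\<open>Jordan_Normal_Form.Determinant\<close>, so that the dimension \<open>m\<close> is an ordinary natural
  number. Rows and columns are indexed from \<open>0\<close>. The homonymous constants of \<open>HOL-Analysis\<close>
  are hidden.
\<close>

hide_const (open) Determinants.det Determinants.trace Finite_Cartesian_Product.vec
  Finite_Cartesian_Product.mat Finite_Cartesian_Product.transpose
hide_type (open) Finite_Cartesian_Product.vec

definition mat_trace :: "real mat \<Rightarrow> real" where
  "mat_trace A = (\<Sum>i<dim_row A. A $$ (i, i))"

definition pos_definite :: "real mat \<Rightarrow> bool" where
  "pos_definite A \<longleftrightarrow> square_mat A \<and> transpose_mat A = A \<and>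
     (\<forall>v\<in>carrier_vec (dim_row A). v \<noteq> 0\<^sub>v (dim_row A) \<longrightarrow> scalar_prod v (A *\<^sub>v v) > 0)"

text \<open>
  A real symmetric \<open>m \<times> m\<close> matrix is given by its \<open>m (m + 1) / 2\<close> entries on and above the
  diagonal, and \<open>(dA)\<close> is Lebesgue measure in these coordinates.
\<close>

definition sym_index :: "nat \<Rightarrow> (nat \<times> nat) set" where
  "sym_index m = {(i, j). i \<le> j \<and> j < m}"

definition sym_lborel :: "nat \<Rightarrow> (nat \<times> nat \<Rightarrow> real) measure" where
  "sym_lborel m = PiM (sym_index m) (\<lambda>_. lborel)"

definition sym_mat :: "nat \<Rightarrow> (nat \<times> nat \<Rightarrow> real) \<Rightarrow> real mat" where
  "sym_mat m x = mat m m (\<lambda>(i, j). x (min i j, max i j))"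

text \<open>
  The base of the complex power is a positive real on the domain of integration, where
  \<open>powr\<close> has its usual meaning \<open>exp (z * ln (det A))\<close> with the real logarithm.
\<close>

definition multivariate_Gamma :: "nat \<Rightarrow> complex \<Rightarrow> complex" where
  "multivariate_Gamma m a =
     (LINT x : {x \<in> space (sym_lborel m). pos_definite (sym_mat m x)} | sym_lborel m.
        of_real (exp (- mat_trace (sym_mat m x))) *
        of_real (det (sym_mat m x)) powr (a - (of_nat m + 1) / 2))"

end

theory Submission
  imports "HOL-Probability.Distributions" Defs
begin

text \<open>
  The proof is by induction on the size of the matrix. Split off the last row and column of a
  symmetric matrix of size \<open>m + 1\<close>, with diagonal entry \<open>c\<close> and remaining column \<open>b\<close>, and write
  the leading block as \<open>S + b b\<^sup>T / c\<close>, so that \<open>S\<close> is its Schur complement. Completing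
  the square in the last variable shows that the matrix is positive definite iff \<open>c > 0\<close> and \<open>S\<close>
  is positive definite (\<open>pos_definite_iff_schur_complement\<close>); moreover the determinant is
  \<open>c det S\<close> and the trace is \<open>c + tr S + |b|\<^sup>2 / c\<close>. Hence in the variables \<open>(c, b, S)\<close> the
  integrand with exponent \<open>z\<close> is the product of \<open>e\<^sup>-\<^sup>c c\<^sup>z\<close>, the Gaussian
  \<open>exp (- |b|\<^sup>2 / c)\<close> and the same integrand in \<open>S\<close> (\<open>Gamma_integrand_bordered\<close>).

  For fixed \<open>c\<close> and \<open>b\<close> the passage from the leading block to \<open>S\<close> is a translation, so the change
  of variables preserves Lebesgue measure (\<open>distr_bordered\<close>). By Fubini, the Gaussian contributes
  \<open>(\<pi> c)\<close> to the power \<open>m / 2\<close>, the integral over \<open>c\<close> is then an Euler integral, and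
  \<open>\<Gamma>\<^bsub>m+1\<^esub>[a] = \<pi>\<^bsup>m/2\<^esup> \<Gamma>(a) \<Gamma>\<^bsub>m\<^esub>[a - 1/2]\<close>.

  Taking the Schur complement of the last entry, rather than that of the leading block, keeps
  the Gaussian a product of one-dimensional ones; the other choice would need the
  Gaussian integral of a general quadratic form. The induction starts at \<open>m = 0\<close>, where the space
  is a single point. Absolute convergence is carried along in the induction, which is why the integrals
  are stated with \<open>has_bochner_integral\<close>.
\<close>

section \<open>Coordinates of bordered matrices\<close>

text \<open>
  Restricted to \<open>sym_index m\<close> so that the value is a point of the space of \<open>sym_lborel m\<close>.
\<close>

definition schur_complement :: "nat \<Rightarrow> (nat \<times> nat \<Rightarrow> real) \<Rightarrow> nat \<times> nat \<Rightarrow> real" where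
  "schur_complement m x =
     (\<lambda>(i, j)\<in>sym_index m. x (i, j) - x (i, m) * x (j, m) / x (m, m))"

definition border_index :: "nat \<Rightarrow> (nat \<times> nat) set" where
  "border_index m = {..<m} \<times> {m}"

text \<open>
  The symmetric matrix with pivot \<open>c\<close>, last column \<open>b\<close> and Schur complement \<open>s\<close>. It is the inverse of
  the change of variables; for \<open>c = 0\<close> the division yields \<open>0\<close>, and the map stays total
  and measurable.
\<close>

definition bordered ::
    "nat \<Rightarrow> real \<times> (nat \<times> nat \<Rightarrow> real) \<times> (nat \<times> nat \<Rightarrow> real) \<Rightarrow> nat \<times> nat \<Rightarrow> real" where
  "bordered m = (\<lambda>(c, b, s). \<lambda>(i, j)\<in>sym_index (Suc m).
     if j < m then s (i, j) + b (i, m) * b (j, m) / c else if i < m then b (i, m) else c)"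

lemma finite_sym_index [simp]: "finite (sym_index m)"
  by (rule finite_subset[of _ "{..m} \<times> {..m}"]) (auto simp: sym_index_def)

lemma finite_border_index [simp]: "finite (border_index m)"
  by (simp add: border_index_def)

lemma sym_index_Suc: "sym_index (Suc m) = insert (m, m) (border_index m \<union> sym_index m)"
  by (auto simp: sym_index_def border_index_def)

lemma border_index_disjoint: "border_index m \<inter> sym_index m = {}"
  "(m, m) \<notin> border_index m \<union> sym_index m"
  by (auto simp: sym_index_def border_index_def)

lemma space_sym_lborel: "space (sym_lborel m) = extensional (sym_index m)"
  by (simp add: sym_lborel_def space_PiM PiE_def)

interpretation lborel_product: product_sigma_finite "\<lambda>_. lborel :: real measure"
  by standard

interpretation sym_lborel: sigma_finite_measure "sym_lborel m"
  unfolding sym_lborel_def by (rule lborel_product.sigma_finite) simp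

lemma schur_complement_bordered:
  assumes "s \<in> space (sym_lborel m)"
  shows "schur_complement m (bordered m (c, b, s)) = s"
proof
  fix p
  show "schur_complement m (bordered m (c, b, s)) p = s p"
    using assms
    by (cases p) (auto simp: schur_complement_def bordered_def restrict_def sym_index_def
        space_sym_lborel extensional_def)
qed

section \<open>Schur complements of symmetric matrices\<close>

text \<open>
  Test vectors become functions on all indices, so that one function can be tested against matrices
  of sizes \<open>m\<close> and \<open>m + 1\<close>.
\<close>

lemma pos_definite_sym_mat_iff:
  "pos_definite (sym_mat m x) \<longleftrightarrow>
     (\<forall>f. (\<exists>i<m. f i \<noteq> 0) \<longrightarrow> (\<Sum>i<m. \<Sum>j<m. f i * x (min i j, max i j) * f j) > 0)"
proof -
  have form: "scalar_prod v (sym_mat m x *\<^sub>v v) =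
      (\<Sum>i<m. \<Sum>j<m. v $ i * x (min i j, max i j) * v $ j)" if "v \<in> carrier_vec m" for v
    using that
    by (auto simp: scalar_prod_def sym_mat_def sum_distrib_left mult.assoc atLeast0LessThan
        intro!: sum.cong)
  have zero: "v \<noteq> 0\<^sub>v m \<longleftrightarrow> (\<exists>i<m. v $ i \<noteq> 0)" if "v \<in> carrier_vec m" for v :: "real vec"
    using that by (auto simp: vec_eq_iff)
  have "pos_definite (sym_mat m x) \<longleftrightarrow> (\<forall>v\<in>carrier_vec m. v \<noteq> 0\<^sub>v m \<longrightarrow>
      scalar_prod v (sym_mat m x *\<^sub>v v) > 0)"
    by (auto simp: pos_definite_def sym_mat_def min.commute max.commute)
  also have "\<dots> \<longleftrightarrow> (\<forall>v\<in>carrier_vec m. (\<exists>i<m. v $ i \<noteq> 0) \<longrightarrow>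
      (\<Sum>i<m. \<Sum>j<m. v $ i * x (min i j, max i j) * v $ j) > 0)"
    by (simp add: form zero)
  also have "\<dots> \<longleftrightarrow> (\<forall>f. (\<exists>i<m. f i \<noteq> 0) \<longrightarrow>
      (\<Sum>i<m. \<Sum>j<m. f i * x (min i j, max i j) * f j) > 0)" (is "?L \<longleftrightarrow> ?R")
  proof
    assume L: ?L
    show ?R
    proof (intro allI impI)
      fix f :: "nat \<Rightarrow> real"
      assume f: "\<exists>i<m. f i \<noteq> 0"
      then have "\<exists>i<m. Matrix.vec m f $ i \<noteq> 0" by auto
      then show "(\<Sum>i<m. \<Sum>j<m. f i * x (min i j, max i j) * f j) > 0"
        using L[rule_format, of "Matrix.vec m f"] by simp
    qed
  qed auto
  finally show ?thesis .
qed

lemma complete_square_last_variable: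
  fixes A :: "nat \<Rightarrow> nat \<Rightarrow> real"
  assumes sym: "\<And>i j. A i j = A j i" and c: "A m m \<noteq> 0"
  shows "(\<Sum>i<Suc m. \<Sum>j<Suc m. f i * A i j * f j) =
    (\<Sum>i<m. \<Sum>j<m. f i * (A i j - A i m * A j m / A m m) * f j) +
    A m m * (f m + (\<Sum>i<m. A i m * f i) / A m m)\<^sup>2"
proof -
  define L where "L = (\<Sum>i<m. A i m * f i)"
  define Q where "Q = (\<Sum>i<m. \<Sum>j<m. f i * A i j * f j)"
  have "(\<Sum>i<m. \<Sum>j<m. f i * (A i j - A i m * A j m / A m m) * f j) =
      Q - (\<Sum>i<m. \<Sum>j<m. (A i m * f i) * (A j m * f j)) / A m m"
    unfolding Q_def sum_divide_distrib sum_subtractf[symmetric]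
    by (intro sum.cong refl) (simp add: field_simps)
  also have "(\<Sum>i<m. \<Sum>j<m. (A i m * f i) * (A j m * f j)) = L\<^sup>2"
    by (simp add: L_def power2_eq_square sum_product)
  finally have schur: "(\<Sum>i<m. \<Sum>j<m. f i * (A i j - A i m * A j m / A m m) * f j) =
      Q - L\<^sup>2 / A m m" .
  have row: "(\<Sum>j<m. f m * A m j * f j) = f m * L"
    by (simp add: L_def sum_distrib_left sym[of m] mult.assoc)
  have col: "(\<Sum>i<m. f i * A i m * f m) = f m * L"
    by (simp add: L_def sum_distrib_left mult_ac)
  have "(\<Sum>i<Suc m. \<Sum>j<Suc m. f i * A i j * f j) = Q + 2 * f m * L + A m m * (f m)\<^sup>2"
    by (simp add: sum.distrib Q_def row col power2_eq_square)
  also have "\<dots> = Q - L\<^sup>2 / A m m + A m m * (f m + L / A m m)\<^sup>2"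
    using c by (simp add: field_simps power2_eq_square)
  finally show ?thesis
    by (simp add: schur L_def)
qed

text \<open>
  By completing the square, the quadratic form is that of the Schur complement in the first \<open>m\<close> variables
  plus \<open>x (m, m)\<close> times the square of a linear form that the last variable can make take any value.
\<close>

lemma pos_definite_iff_schur_complement:
  "pos_definite (sym_mat (Suc m) x) \<longleftrightarrow>
     x (m, m) > 0 \<and> pos_definite (sym_mat m (schur_complement m x))"
proof -
  define A where "A = (\<lambda>i j. x (min i j, max i j))"
  define S where "S = (\<lambda>f :: nat \<Rightarrow> real. \<Sum>i<m. \<Sum>j<m. f i * (A i j - A i m * A j m / A m m) * f j)"
  define Q where "Q = (\<lambda>f :: nat \<Rightarrow> real. \<Sum>i<Suc m. \<Sum>j<Suc m. f i * A i j * f j)"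
  define L where "L = (\<lambda>f :: nat \<Rightarrow> real. \<Sum>i<m. A i m * f i)"
  have A_sym: "A i j = A j i" for i j
    by (simp add: A_def min.commute max.commute)
  have pd_x: "pos_definite (sym_mat (Suc m) x) \<longleftrightarrow> (\<forall>f. (\<exists>i<Suc m. f i \<noteq> 0) \<longrightarrow> Q f > 0)"
    by (simp only: pos_definite_sym_mat_iff Q_def A_def)
  have pd_S: "pos_definite (sym_mat m (schur_complement m x)) \<longleftrightarrow>
      (\<forall>f. (\<exists>i<m. f i \<noteq> 0) \<longrightarrow> S f > 0)"
  proof -
    have "(\<Sum>i<m. \<Sum>j<m. f i * schur_complement m x (min i j, max i j) * f j) = S f" for f
      unfolding S_def
      by (intro sum.cong refl)
        (auto simp: schur_complement_def sym_index_def A_def min_def max_def)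
    then show ?thesis
      by (simp add: pos_definite_sym_mat_iff)
  qed
  have Q_eq: "Q f = S f + A m m * (f m + L f / A m m)\<^sup>2" if "A m m \<noteq> 0" for f
    unfolding Q_def S_def L_def using A_sym that by (rule complete_square_last_variable)
  have "A m m > 0" if "\<forall>f. (\<exists>i<Suc m. f i \<noteq> 0) \<longrightarrow> Q f > 0"
  proof -
    have "Q (\<lambda>i. if i = m then 1 else 0) = A m m"
      by (simp add: Q_def)
    then show ?thesis
      using that[rule_format, of "\<lambda>i. if i = m then 1 else 0"] by auto
  qed
  moreover have "S f > 0" if pos: "\<forall>f. (\<exists>i<Suc m. f i \<noteq> 0) \<longrightarrow> Q f > 0" and c: "A m m > 0"
    and f: "\<exists>i<m. f i \<noteq> 0" for f
  proof -
    \<comment> \<open>Choosing the last variable so that the completed square vanishes leaves only the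
      form of the Schur complement.\<close>
    define g where "g = f(m := - L f / A m m)"
    have "L g = L f" and "S g = S f"
      by (simp_all add: L_def S_def g_def)
    then have "Q g = S f"
      using c by (simp add: Q_eq g_def)
    moreover have "\<exists>i<Suc m. g i \<noteq> 0"
      using f by (auto simp: g_def intro: less_SucI)
    ultimately show ?thesis
      using pos by metis
  qed
  moreover have "Q f > 0" if c: "A m m > 0" and S: "\<forall>f. (\<exists>i<m. f i \<noteq> 0) \<longrightarrow> S f > 0"
    and f: "\<exists>i<Suc m. f i \<noteq> 0" for f
  proof (cases "\<exists>i<m. f i \<noteq> 0")
    case True
    then show ?thesis
      using c S by (simp add: Q_eq add_pos_nonneg)
  next
    case False
    then have "S f = 0" "L f = 0" "f m \<noteq> 0"
      using f by (auto simp: S_def L_def less_Suc_eq)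
    then show ?thesis
      using c by (simp add: Q_eq)
  qed
  ultimately show ?thesis
    unfolding pd_x pd_S by (auto simp: A_def)
qed

text \<open>
  Block elimination: a unitriangular factor on the left turns the matrix into a block triangular one
  with diagonal blocks the Schur complement and the pivot.
\<close>

lemma det_eq_pivot_times_schur_complement:
  fixes A :: "'a :: field mat"
  assumes A: "A \<in> carrier_mat (Suc m) (Suc m)" and c: "A $$ (m, m) \<noteq> 0"
  shows "det A = A $$ (m, m) *
    det (mat m m (\<lambda>(i, j). A $$ (i, j) - A $$ (i, m) * A $$ (m, j) / A $$ (m, m)))"
proof -
  let ?c = "A $$ (m, m)"
  define S where "S = mat m m (\<lambda>(i, j). A $$ (i, j) - A $$ (i, m) * A $$ (m, j) / ?c)"
  define U where "U = mat m 1 (\<lambda>(i, j). A $$ (i, m) / ?c)"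
  define R where "R = mat 1 m (\<lambda>(i, j). A $$ (m, j))"
  define C where "C = mat 1 1 (\<lambda>_. ?c)"
  have carrier [simp]: "S \<in> carrier_mat m m" "U \<in> carrier_mat m 1" "R \<in> carrier_mat 1 m"
    "C \<in> carrier_mat 1 1"
    by (auto simp: S_def U_def R_def C_def)
  have "A = four_block_mat (S + U * R) (U * C) R C"
    using A c by (intro eq_matI)
      (auto simp: S_def U_def R_def C_def four_block_mat_def scalar_prod_def Let_def less_Suc_eq)
  also have "\<dots> = four_block_mat (1\<^sub>m m) U (0\<^sub>m 1 m) (1\<^sub>m 1) * four_block_mat S (0\<^sub>m m 1) R C"
    using left_mult_one_mat[of S m m] left_mult_one_mat[of R 1 m] left_mult_one_mat[of C 1 1]
      left_add_zero_mat[of "U * C" m 1] left_add_zero_mat[of R 1 m] left_add_zero_mat[of C 1 1]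
      left_mult_zero_mat[of S m m 1]
    by (subst mult_four_block_mat[of _ m m _ 1 _ 1 _ _ m _ 1])
      (simp_all del: One_nat_def add: mult_carrier_mat[of U m 1 C 1])
  also have "det \<dots> = det (four_block_mat (1\<^sub>m m) U (0\<^sub>m 1 m) (1\<^sub>m 1)) *
      det (four_block_mat S (0\<^sub>m m 1) R C)"
    by (rule det_mult[of _ "m + 1"]; rule four_block_carrier_mat) (simp_all del: One_nat_def)
  also have "det (four_block_mat (1\<^sub>m m) U (0\<^sub>m 1 m) (1\<^sub>m 1)) = 1"
    by (subst det_four_block_mat_lower_left_zero[of _ m _ 1]) (simp_all del: One_nat_def)
  also have "det (four_block_mat S (0\<^sub>m m 1) R C) = det S * det C"
    by (rule det_four_block_mat_upper_right_zero[OF carrier(1) refl carrier(3,4)])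
  also have "det C = ?c"
    by (simp add: C_def det_single)
  finally show ?thesis
    by (simp add: S_def)
qed

lemma det_sym_mat_Suc:
  assumes "x (m, m) \<noteq> 0"
  shows "det (sym_mat (Suc m) x) = x (m, m) * det (sym_mat m (schur_complement m x))"
proof -
  have "sym_mat m (schur_complement m x) = mat m m (\<lambda>(i, j). sym_mat (Suc m) x $$ (i, j) -
      sym_mat (Suc m) x $$ (i, m) * sym_mat (Suc m) x $$ (m, j) / sym_mat (Suc m) x $$ (m, m))"
    by (intro eq_matI)
      (auto simp: sym_mat_def schur_complement_def sym_index_def min_def max_def)
  then show ?thesis
    using assms det_eq_pivot_times_schur_complement[of "sym_mat (Suc m) x" m]
    by (simp add: sym_mat_def)
qed

lemma det_pos_if_pos_definite: "pos_definite (sym_mat m x) \<Longrightarrow> det (sym_mat m x) > 0"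
proof (induction m arbitrary: x)
  case 0
  then show ?case by (simp add: sym_mat_def)
next
  case (Suc m)
  then show ?case
    by (simp add: pos_definite_iff_schur_complement det_sym_mat_Suc)
qed

section \<open>The change of variables preserves Lebesgue measure\<close>

lemma PiM_lborel_translation:
  fixes t :: "'i \<Rightarrow> real"
  assumes "finite I"
  shows "distr (PiM I (\<lambda>_. lborel)) (PiM I (\<lambda>_. lborel)) (\<lambda>x. \<lambda>i\<in>I. x i + t i) =
    PiM I (\<lambda>_. lborel)" (is "distr ?P ?P ?T = ?P")
proof (rule lborel_product.PiM_eqI)
  fix A :: "'i \<Rightarrow> real set"
  assume A: "\<And>i. i \<in> I \<Longrightarrow> A i \<in> sets lborel"
  have T: "?T \<in> measurable ?P ?P"
    by measurable
  have preimage: "?T -` PiE I A \<inter> space ?P = PiE I (\<lambda>i. (\<lambda>y. y + t i) -` A i)"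
    by (auto simp: space_PiM PiE_def Pi_def)
  have "emeasure (distr ?P ?P ?T) (PiE I A) = emeasure ?P (PiE I (\<lambda>i. (\<lambda>y. y + t i) -` A i))"
    using A assms by (subst emeasure_distr[OF T]) (auto simp: preimage intro!: sets_PiM_I_finite)
  also have "\<dots> = (\<Prod>i\<in>I. emeasure lborel ((\<lambda>y. y + t i) -` A i))"
  proof (rule lborel_product.emeasure_PiM)
    show "(\<lambda>y. y + t i) -` A i \<in> sets lborel" if "i \<in> I" for i
      using measurable_sets[of "\<lambda>y. y + t i" lborel lborel, OF _ A[OF that]] by simp
  qed (fact assms)
  also have "\<dots> = (\<Prod>i\<in>I. emeasure lborel (A i))"
  proof (rule prod.cong[OF refl])
    fix i
    assume i: "i \<in> I"
    have "emeasure lborel (A i) = emeasure (distr lborel borel ((+) (t i))) (A i)"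
      by (simp add: lborel_distr_plus)
    also have "\<dots> = emeasure lborel ((+) (t i) -` A i \<inter> space lborel)"
      using A[OF i] by (intro emeasure_distr) auto
    finally show "emeasure lborel ((\<lambda>y. y + t i) -` A i) = emeasure lborel (A i)"
      by (simp add: add.commute vimage_def)
  qed
  finally show "emeasure (distr ?P ?P ?T) (PiE I A) = (\<Prod>i\<in>I. emeasure lborel (A i))" .
qed (use assms in auto)

abbreviation border_lborel :: "nat \<Rightarrow> (nat \<times> nat \<Rightarrow> real) measure" where
  "border_lborel m \<equiv> PiM (border_index m) (\<lambda>_. lborel)"

interpretation border_lborel: sigma_finite_measure "border_lborel m"
  by (rule lborel_product.sigma_finite) simp

lemma measurable_sym_lborel_component:
  "p \<in> sym_index m \<Longrightarrow> (\<lambda>x. x p) \<in> borel_measurable (sym_lborel m)"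
  unfolding sym_lborel_def
  using measurable_component_singleton[of p "sym_index m" "\<lambda>_. lborel"] by simp

lemma measurable_border_lborel_component:
  "p \<in> border_index m \<Longrightarrow> (\<lambda>x. x p) \<in> borel_measurable (border_lborel m)"
  using measurable_component_singleton[of p "border_index m" "\<lambda>_. lborel"] by simp

lemma measurable_schur_complement [measurable]:
  "schur_complement m \<in> measurable (sym_lborel (Suc m)) (sym_lborel m)"
proof -
  have "(\<lambda>x. case p of (i, j) \<Rightarrow> x (i, j) - x (i, m) * x (j, m) / x (m, m))
      \<in> measurable (sym_lborel (Suc m)) lborel" if "p \<in> sym_index m" for p
  proof -
    obtain i j where p: "p = (i, j)" by (cases p)
    have [simp]: "(i, j) \<in> sym_index (Suc m)" "(i, m) \<in> sym_index (Suc m)"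
      "(j, m) \<in> sym_index (Suc m)" "(m, m) \<in> sym_index (Suc m)"
      using that by (auto simp: p sym_index_def)
    show ?thesis
      by (auto simp: p intro!: borel_measurable_diff borel_measurable_divide
          borel_measurable_times measurable_sym_lborel_component)
  qed
  then show ?thesis
    unfolding schur_complement_def sym_lborel_def[of m] by (rule measurable_restrict)
qed

lemma measurable_bordered [measurable]:
  "bordered m \<in> measurable (lborel \<Otimes>\<^sub>M (border_lborel m \<Otimes>\<^sub>M sym_lborel m)) (sym_lborel (Suc m))"
proof -
  let ?M = "lborel \<Otimes>\<^sub>M (border_lborel m \<Otimes>\<^sub>M sym_lborel m) ::
    (real \<times> (nat \<times> nat \<Rightarrow> real) \<times> (nat \<times> nat \<Rightarrow> real)) measure"
  have "(\<lambda>w. case w of (c, b, s) \<Rightarrow> case p of (i, j) \<Rightarrow>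
      if j < m then s (i, j) + b (i, m) * b (j, m) / c else if i < m then b (i, m) else c)
      \<in> measurable ?M lborel" if "p \<in> sym_index (Suc m)" for p
  proof -
    obtain i j where p: "p = (i, j)" by (cases p)
    have [simp]: "i < m \<Longrightarrow> (i, m) \<in> border_index m" for i
      by (simp add: border_index_def)
    have [simp]: "(i, j) \<in> sym_index m" "i < m" if "j < m"
      using that \<open>p \<in> sym_index (Suc m)\<close> by (simp_all add: p sym_index_def)
    have border [measurable]: "(\<lambda>w. fst (snd w) (i, m)) \<in> borel_measurable ?M" if "i < m" for i
      using that by (intro measurable_compose[OF _ measurable_border_lborel_component[of _ m]]) simp_all
    have block [measurable]: "(\<lambda>w. snd (snd w) (i, j)) \<in> borel_measurable ?M" if "j < m"
      using that by (intro measurable_compose[OF _ measurable_sym_lborel_component[of _ m]]) simp_all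
    show ?thesis
      by (cases "j < m"; cases "i < m") (simp_all add: p case_prod_unfold)
  qed
  then have "(\<lambda>w. \<lambda>p\<in>sym_index (Suc m). case w of (c, b, s) \<Rightarrow> case p of (i, j) \<Rightarrow>
      if j < m then s (i, j) + b (i, m) * b (j, m) / c else if i < m then b (i, m) else c)
      \<in> measurable ?M (sym_lborel (Suc m))"
    unfolding sym_lborel_def[of "Suc m"] by (rule measurable_restrict)
  also have "(\<lambda>w. \<lambda>p\<in>sym_index (Suc m). case w of (c, b, s) \<Rightarrow> case p of (i, j) \<Rightarrow>
      if j < m then s (i, j) + b (i, m) * b (j, m) / c else if i < m then b (i, m) else c)
      = bordered m"
    by (auto simp: bordered_def fun_eq_iff restrict_def)
  finally show ?thesis .
qed

text \<open>
  With \<open>c\<close> and \<open>b\<close> fixed, \<open>bordered\<close> translates the block \<open>s\<close> by \<open>b b\<^sup>T / c\<close> and then only puts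
  the three groups of coordinates together; so Tonelli and the invariance of Lebesgue measure under
  translations suffice, and no Jacobian has to be computed.
\<close>

lemma distr_bordered:
  "distr (lborel \<Otimes>\<^sub>M (border_lborel m \<Otimes>\<^sub>M sym_lborel m)) (sym_lborel (Suc m)) (bordered m) =
    sym_lborel (Suc m)" (is "distr ?M ?N _ = _")
proof (rule measure_eqI)
  fix A
  assume "A \<in> sets (distr ?M ?N (bordered m))"
  then have A [measurable]: "A \<in> sets (sym_lborel (Suc m))" by simp
  interpret tail: pair_sigma_finite "border_lborel m" "sym_lborel m" ..
  let ?J = "border_index m" and ?I = "sym_index m"
  let ?g = "indicator A :: _ \<Rightarrow> ennreal"
  \<comment> \<open>The same assembly of coordinates without the translation.\<close>
  define glue where "glue = (\<lambda>c b s. (merge ?J ?I (b, s))((m, m) := c :: real))"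
  have glue_measurable: "(\<lambda>s. glue c b s) \<in> measurable (sym_lborel m) (sym_lborel (Suc m))"
    if b: "b \<in> space (border_lborel m)" for c b
  proof -
    have "(\<lambda>s. merge ?J ?I (b, s)) \<in> measurable (sym_lborel m) (PiM (?J \<union> ?I) (\<lambda>_. lborel))"
      unfolding sym_lborel_def using b by measurable
    then show ?thesis
      unfolding glue_def sym_lborel_def[of "Suc m"] sym_index_Suc
      by (intro measurable_fun_upd[where J = "?J \<union> ?I"]) auto
  qed
  have shift: "(\<integral>\<^sup>+ s. ?g (bordered m (c, b, s)) \<partial>sym_lborel m) =
      (\<integral>\<^sup>+ s. ?g (glue c b s) \<partial>sym_lborel m)" if b: "b \<in> space (border_lborel m)" for c b
  proof -
    define T where "T = (\<lambda>s. \<lambda>p\<in>?I. s p + b (fst p, m) * b (snd p, m) / c)"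
    have T: "T \<in> measurable (sym_lborel m) (sym_lborel m)"
      unfolding T_def sym_lborel_def by measurable
    have "bordered m (c, b, s) = glue c b (T s)" if "s \<in> space (sym_lborel m)" for s
    proof
      fix p
      show "bordered m (c, b, s) p = glue c b (T s) p"
        by (cases p) (auto simp: bordered_def glue_def T_def merge_def sym_index_def
            border_index_def restrict_def)
    qed
    then have "(\<integral>\<^sup>+ s. ?g (bordered m (c, b, s)) \<partial>sym_lborel m) =
        (\<integral>\<^sup>+ s. ?g (glue c b (T s)) \<partial>sym_lborel m)"
      by (intro nn_integral_cong) simp
    also have "\<dots> = (\<integral>\<^sup>+ s. ?g (glue c b s) \<partial>distr (sym_lborel m) (sym_lborel m) T)"
      using glue_measurable[OF b, of c] T by (subst nn_integral_distr) simp_all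
    also have "distr (sym_lborel m) (sym_lborel m) T = sym_lborel m"
      unfolding T_def sym_lborel_def by (rule PiM_lborel_translation) simp
    finally show ?thesis .
  qed
  have "emeasure (distr ?M ?N (bordered m)) A = (\<integral>\<^sup>+ x. ?g x \<partial>distr ?M ?N (bordered m))"
    by simp
  also have "\<dots> = (\<integral>\<^sup>+ w. ?g (bordered m w) \<partial>?M)"
    by (rule nn_integral_distr) simp_all
  also have "\<dots> = (\<integral>\<^sup>+ c. \<integral>\<^sup>+ y. ?g (bordered m (c, y)) \<partial>(border_lborel m \<Otimes>\<^sub>M sym_lborel m) \<partial>lborel)"
    by (subst sigma_finite_measure.nn_integral_fst[OF tail.sigma_finite_measure_axioms, symmetric]) measurable
  also have "\<dots> = (\<integral>\<^sup>+ c. \<integral>\<^sup>+ b. \<integral>\<^sup>+ s. ?g (bordered m (c, b, s)) \<partial>sym_lborel m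
      \<partial>border_lborel m \<partial>lborel)"
    by (intro nn_integral_cong, subst sym_lborel.nn_integral_fst[symmetric]) measurable
  also have "\<dots> = (\<integral>\<^sup>+ c. \<integral>\<^sup>+ b. \<integral>\<^sup>+ s. ?g (glue c b s) \<partial>sym_lborel m
      \<partial>border_lborel m \<partial>lborel)"
    by (intro nn_integral_cong shift)
  also have "\<dots> = (\<integral>\<^sup>+ c. \<integral>\<^sup>+ x. ?g (x((m, m) := c)) \<partial>PiM (?J \<union> ?I) (\<lambda>_. lborel) \<partial>lborel)"
  proof (intro nn_integral_cong)
    fix c :: real
    have "(\<lambda>x. x((m, m) := c)) \<in> measurable (PiM (?J \<union> ?I) (\<lambda>_. lborel)) (sym_lborel (Suc m))"
      unfolding sym_lborel_def[of "Suc m"] sym_index_Suc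
      by (intro measurable_fun_upd[where J = "?J \<union> ?I"]) auto
    then have "(\<lambda>x. ?g (x((m, m) := c))) \<in> borel_measurable (PiM (?J \<union> ?I) (\<lambda>_. lborel))"
      by measurable
    then show "(\<integral>\<^sup>+ b. \<integral>\<^sup>+ s. ?g (glue c b s) \<partial>sym_lborel m \<partial>border_lborel m) =
        (\<integral>\<^sup>+ x. ?g (x((m, m) := c)) \<partial>PiM (?J \<union> ?I) (\<lambda>_. lborel))"
      unfolding glue_def sym_lborel_def[of m]
      by (subst lborel_product.product_nn_integral_fold) (simp_all add: border_index_disjoint)
  qed
  also have "\<dots> = (\<integral>\<^sup>+ x. ?g x \<partial>PiM (insert (m, m) (?J \<union> ?I)) (\<lambda>_. lborel))"
    using A border_index_disjoint(2)
    by (subst lborel_product.product_nn_integral_insert_rev)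
      (simp_all add: sym_lborel_def sym_index_Suc)
  also have "\<dots> = emeasure (sym_lborel (Suc m)) A"
    using A by (simp add: sym_lborel_def sym_index_Suc)
  finally show "emeasure (distr ?M ?N (bordered m)) A = emeasure (sym_lborel (Suc m)) A" .
qed simp

section \<open>Fubini, Gaussian and Euler integrals\<close>

text \<open>
  Fubini in the form used below: the iterated integral is known for the function itself and for its
  norm, the latter being what yields integrability on the product.
\<close>

lemma has_bochner_integral_pair:
  fixes f :: "_ \<Rightarrow> _ :: {banach, second_countable_topology}"
  assumes "sigma_finite_measure M" "sigma_finite_measure N"
    and f: "f \<in> borel_measurable (M \<Otimes>\<^sub>M N)"
    and inner: "\<And>x. x \<in> space M \<Longrightarrow> has_bochner_integral N (\<lambda>y. f (x, y)) (g x)"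
    and norm_inner: "\<And>x. x \<in> space M \<Longrightarrow> (\<integral>y. norm (f (x, y)) \<partial>N) = h x"
    and h: "integrable M h"
    and outer: "has_bochner_integral M g I"
  shows "has_bochner_integral (M \<Otimes>\<^sub>M N) f I"
proof -
  interpret M: sigma_finite_measure M by fact
  interpret N: sigma_finite_measure N by fact
  interpret pair_sigma_finite M N ..
  have "integrable (M \<Otimes>\<^sub>M N) f"
  proof (rule Fubini_integrable[OF f])
    show "integrable M (\<lambda>x. \<integral>y. norm (f (x, y)) \<partial>N)"
      using h by (subst Bochner_Integration.integrable_cong[OF refl norm_inner])
    show "AE x in M. integrable N (\<lambda>y. f (x, y))"
      using inner by (intro AE_I2) (auto simp: has_bochner_integral_iff)
  qed
  moreover from this have "integral\<^sup>L (M \<Otimes>\<^sub>M N) f = (\<integral>x. \<integral>y. f (x, y) \<partial>N \<partial>M)"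
    by (rule integral_fst'[symmetric])
  moreover have "\<dots> = (\<integral>x. g x \<partial>M)"
    using inner by (intro Bochner_Integration.integral_cong) (auto simp: has_bochner_integral_iff)
  ultimately show ?thesis
    using outer by (simp add: has_bochner_integral_iff)
qed

lemma has_bochner_integral_pair_mult:
  fixes f :: "_ \<Rightarrow> 'c :: {real_normed_field, banach, second_countable_topology}"
  assumes "sigma_finite_measure M" "sigma_finite_measure N"
    and f: "has_bochner_integral M f I" and g: "has_bochner_integral N g J"
  shows "has_bochner_integral (M \<Otimes>\<^sub>M N) (\<lambda>(x, y). f x * g y) (I * J)"
proof -
  have [measurable]: "f \<in> borel_measurable M" "g \<in> borel_measurable N"
    using f g by (auto simp: has_bochner_integral_iff)
  show ?thesis
  proof (rule has_bochner_integral_pair[where g = "\<lambda>x. f x * J" and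
        h = "\<lambda>x. norm (f x) * (\<integral>y. norm (g y) \<partial>N)"])
    show "has_bochner_integral N (\<lambda>y. case (x, y) of (x, y) \<Rightarrow> f x * g y) (f x * J)" for x
      using has_bochner_integral_mult_right[of "f x" N g J] g by simp
    show "has_bochner_integral M (\<lambda>x. f x * J) (I * J)"
      using has_bochner_integral_mult_left[of J M f I] f by simp
    show "integrable M (\<lambda>x. norm (f x) * (\<integral>y. norm (g y) \<partial>N))"
      using f by (intro integrable_mult_left integrable_norm) (auto simp: has_bochner_integral_iff)
  qed (simp_all add: assms norm_mult)
qed

text \<open>The normal density of variance \<open>c / 2\<close>, without its normalising factor.\<close>

lemma has_bochner_integral_Gaussian:
  fixes c :: real
  assumes "c > 0"
  shows "has_bochner_integral lborel (\<lambda>x. exp (- x\<^sup>2 / c)) (sqrt (pi * c))"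
proof -
  have "has_bochner_integral lborel (normal_density 0 (sqrt (c / 2))) 1"
    using assms by (simp add: has_bochner_integral_iff)
  then have "has_bochner_integral lborel
      (\<lambda>x. sqrt (pi * c) * normal_density 0 (sqrt (c / 2)) x) (sqrt (pi * c) * 1)"
    by (intro has_bochner_integral_mult_right) auto
  then show ?thesis
    using assms by (simp add: normal_density_def)
qed

lemma has_bochner_integral_Gaussian_product:
  fixes c :: real
  assumes "c > 0"
  shows "has_bochner_integral (border_lborel m)
    (\<lambda>b. exp (- (\<Sum>p\<in>border_index m. (b p)\<^sup>2) / c)) (sqrt (pi * c) ^ m)"
proof -
  have "exp (- (\<Sum>p\<in>border_index m. (b p)\<^sup>2) / c) = (\<Prod>p\<in>border_index m. exp (- (b p)\<^sup>2 / c))"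
    for b :: "nat \<times> nat \<Rightarrow> real"
    by (simp add: exp_sum[symmetric] sum_negf sum_divide_distrib)
  moreover have "card (border_index m) = m"
    by (simp add: border_index_def)
  ultimately show ?thesis
    using has_bochner_integral_Gaussian[OF assms]
      lborel_product.product_integrable_prod[of "border_index m" "\<lambda>_ x. exp (- x\<^sup>2 / c)"]
      lborel_product.product_integral_prod[of "border_index m" "\<lambda>_ x. exp (- x\<^sup>2 / c)"]
    by (simp add: has_bochner_integral_iff)
qed

text \<open>
  The value field is left general because the factor \<open>F\<close> is complex when the integral is evaluated and
  real when its norm is.
\<close>

lemma has_bochner_integral_Gaussian_mult:
  fixes c :: real
    and F :: "(nat \<times> nat \<Rightarrow> real) \<Rightarrow> 'c :: {real_normed_field, banach, second_countable_topology}"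
  assumes "c > 0" and F: "has_bochner_integral (sym_lborel m) F I"
  shows "has_bochner_integral (border_lborel m \<Otimes>\<^sub>M sym_lborel m)
    (\<lambda>(b, s). of_real (exp (- (\<Sum>p\<in>border_index m. (b p)\<^sup>2) / c)) * F s)
    (of_real (sqrt (pi * c) ^ m) * I)"
  by (intro has_bochner_integral_pair_mult F has_bochner_integral_of_real
      has_bochner_integral_Gaussian_product assms(1)
      border_lborel.sigma_finite_measure_axioms sym_lborel.sigma_finite_measure_axioms)

lemma has_bochner_integral_Gamma:
  assumes "Re a > 0"
  shows "has_bochner_integral lborel
    (\<lambda>c. if c > 0 then complex_of_real (exp (- c)) * of_real c powr (a - 1) else 0) (Gamma a)"
proof -
  let ?f = "\<lambda>t. complex_of_real t powr (a - 1) / of_real (exp t)"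
  let ?g = "\<lambda>c. if c > 0 then complex_of_real (exp (- c)) * of_real c powr (a - 1) else 0"
  have eq: "indicator {0<..} t *\<^sub>R ?f t = ?g t" for t :: real
    by (simp add: exp_minus divide_inverse mult.commute indicator_def)
  \<comment> \<open>Measurability is read off from the logarithm and the exponential.\<close>
  have *: "?g t = (if t > 0 then exp (of_real (- t)) * exp ((a - 1) * of_real (ln t)) else 0)" for t
    using exp_of_real[of "- t", where 'a = complex] by (simp add: powr_def Ln_of_real)
  have "?g \<in> borel_measurable lborel"
    unfolding * by measurable
  moreover have "set_integrable lebesgue {0<..} ?f"
    by (rule absolutely_integrable_Gamma_integral'[OF assms])
  ultimately have int: "integrable lborel ?g"
    unfolding set_integrable_def eq by (simp add: integrable_completion)
  then have "set_integrable lborel {0<..} ?f"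
    unfolding set_integrable_def eq .
  then have "(LINT t : {0<..} | lborel. ?f t) = Gamma a"
    using Gamma_integral_complex'[OF assms]
    by (simp add: set_borel_integral_eq_integral integral_unique)
  then show ?thesis
    using int unfolding set_lebesgue_integral_def eq by (simp add: has_bochner_integral_iff)
qed

text \<open>
  The Gaussian integral raises the exponent of the pivot by \<open>m / 2\<close>, which is what turns the
  pivot integral into an Euler integral at the right argument.
\<close>

lemma of_real_powr_times_sqrt_power:
  fixes c :: real
  assumes "c > 0"
  shows "complex_of_real c powr z * of_real (sqrt (pi * c) ^ m) =
    of_real (pi powr (real m / 2)) * of_real c powr (z + of_nat m / 2)"
proof -
  have "sqrt (pi * c) ^ m = (pi * c) powr (real m / 2)"
    using assms by (simp add: powr_half_sqrt[symmetric] powr_powr flip: powr_realpow)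
  also have "\<dots> = pi powr (real m / 2) * c powr (real m / 2)"
    using assms by (simp add: powr_mult)
  finally have "complex_of_real (sqrt (pi * c) ^ m) =
      of_real (pi powr (real m / 2)) * of_real c powr (of_nat m / 2)"
    using assms powr_of_real[of c "real m / 2"] by simp
  then show ?thesis
    by (simp only: powr_add mult_ac)
qed

section \<open>The recursion in the size of the matrix\<close>

text \<open>
  The integrand extended by \<open>0\<close> beyond the positive definite cone, with a free exponent: the recursion
  leaves the exponent unchanged, although the argument of the multivariate gamma function moves
  by \<open>1/2\<close>.
\<close>

definition Gamma_integrand :: "nat \<Rightarrow> complex \<Rightarrow> (nat \<times> nat \<Rightarrow> real) \<Rightarrow> complex" where
  "Gamma_integrand m z x = (if pos_definite (sym_mat m x) then
     of_real (exp (- mat_trace (sym_mat m x))) * of_real (det (sym_mat m x)) powr z else 0)"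

lemma multivariate_Gamma_eq:
  "multivariate_Gamma m a =
    integral\<^sup>L (sym_lborel m) (Gamma_integrand m (a - (of_nat m + 1) / 2))"
  unfolding multivariate_Gamma_def set_lebesgue_integral_def
  by (intro Bochner_Integration.integral_cong) (auto simp: Gamma_integrand_def)

text \<open>
  The definition quantifies over uncountably many vectors; the Schur complement criterion, applied
  repeatedly, replaces this by the positivity of finitely many pivots.
\<close>

lemma measurable_pos_definite [measurable]:
  "Measurable.pred (sym_lborel m) (\<lambda>x. pos_definite (sym_mat m x))"
proof (induction m)
  case 0
  have "pos_definite (sym_mat 0 x)" for x
    by (simp add: pos_definite_sym_mat_iff)
  then show ?case by simp
next
  case (Suc m)
  note Suc.IH [measurable]
  have [measurable]: "(\<lambda>x. x (m, m)) \<in> borel_measurable (sym_lborel (Suc m))"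
    by (rule measurable_sym_lborel_component) (simp add: sym_index_def)
  show ?case
    unfolding pos_definite_iff_schur_complement by measurable
qed

lemma measurable_Gamma_integrand [measurable]:
  "Gamma_integrand m z \<in> borel_measurable (sym_lborel m)"
proof -
  have entry [measurable]: "(\<lambda>x. sym_mat m x $$ (i, j)) \<in> borel_measurable (sym_lborel m)"
    if "i < m" "j < m" for i j
  proof -
    have "(min i j, max i j) \<in> sym_index m"
      using that by (auto simp: sym_index_def)
    then show ?thesis
      using that by (simp add: sym_mat_def measurable_sym_lborel_component)
  qed
  have [measurable]: "(\<lambda>x. mat_trace (sym_mat m x)) \<in> borel_measurable (sym_lborel m)"
  proof -
    have "mat_trace (sym_mat m x) = (\<Sum>i<m. sym_mat m x $$ (i, i))" for x
      by (simp add: mat_trace_def sym_mat_def)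
    then show ?thesis
      by (auto intro!: borel_measurable_sum entry)
  qed
  have [measurable]: "(\<lambda>x. det (sym_mat m x)) \<in> borel_measurable (sym_lborel m)"
  proof -
    have "det (sym_mat m x) = (\<Sum>p\<in>{p. p permutes {0..<m}}. signof p *
        (\<Prod>i = 0..<m. sym_mat m x $$ (i, p i)))" for x
      by (simp add: det_def sym_mat_def)
    then show ?thesis
      using permutes_in_image[of _ "{0..<m}"]
      by (auto intro!: borel_measurable_sum borel_measurable_times borel_measurable_prod entry)
  qed
  \<comment> \<open>On the cone the determinant is positive, so the complex power is an exponential of the real
    logarithm.\<close>
  have "Gamma_integrand m z = (\<lambda>x. if pos_definite (sym_mat m x) then
      of_real (exp (- mat_trace (sym_mat m x))) * exp (z * of_real (ln (det (sym_mat m x)))) else 0)"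
  proof
    fix x
    show "Gamma_integrand m z x = (if pos_definite (sym_mat m x) then
        of_real (exp (- mat_trace (sym_mat m x))) * exp (z * of_real (ln (det (sym_mat m x)))) else 0)"
      using det_pos_if_pos_definite[of m x]
      by (cases "pos_definite (sym_mat m x)") (simp_all add: Gamma_integrand_def powr_def Ln_of_real)
  qed
  then show ?thesis
    by simp
qed

lemma mat_trace_bordered:
  assumes "s \<in> space (sym_lborel m)"
  shows "mat_trace (sym_mat (Suc m) (bordered m (c, b, s))) =
    c + mat_trace (sym_mat m s) + (\<Sum>p\<in>border_index m. (b p)\<^sup>2) / c"
proof -
  have "(\<Sum>p\<in>border_index m. (b p)\<^sup>2) = (\<Sum>i<m. (b (i, m))\<^sup>2)"
  proof -
    have "border_index m = (\<lambda>i. (i, m)) ` {..<m}"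
      by (auto simp: border_index_def)
    then show ?thesis
      by (simp add: sum.reindex inj_on_def)
  qed
  then show ?thesis
    by (simp add: mat_trace_def sym_mat_def bordered_def sym_index_def sum.distrib
        sum_divide_distrib power2_eq_square)
qed

text \<open>
  The factorisation is exact for every \<open>c\<close>: for \<open>c \<le> 0\<close> both sides vanish, as the matrix then has a
  nonpositive diagonal entry.
\<close>

lemma Gamma_integrand_bordered:
  assumes s: "s \<in> space (sym_lborel m)"
  shows "Gamma_integrand (Suc m) z (bordered m (c, b, s)) =
    (if c > 0 then of_real (exp (- c)) * of_real c powr z else 0) *
    (of_real (exp (- (\<Sum>p\<in>border_index m. (b p)\<^sup>2) / c)) * Gamma_integrand m z s)"
proof -
  let ?x = "bordered m (c, b, s)"
  have pivot: "?x (m, m) = c"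
    by (simp add: bordered_def sym_index_def)
  show ?thesis
  proof (cases "c > 0 \<and> pos_definite (sym_mat m s)")
    case True
    then have "det (sym_mat (Suc m) ?x) = c * det (sym_mat m s)"
      using s by (simp add: det_sym_mat_Suc schur_complement_bordered pivot)
    then have "complex_of_real (det (sym_mat (Suc m) ?x)) powr z =
        of_real c powr z * of_real (det (sym_mat m s)) powr z"
      using True det_pos_if_pos_definite[of m s] by (simp add: powr_times_real)
    moreover have "exp (- mat_trace (sym_mat (Suc m) ?x)) = exp (- c) *
        (exp (- (\<Sum>p\<in>border_index m. (b p)\<^sup>2) / c) * exp (- mat_trace (sym_mat m s)))"
      by (simp add: mat_trace_bordered[OF s] flip: exp_add)
    ultimately show ?thesis
      using True s by (simp add: Gamma_integrand_def pos_definite_iff_schur_complement pivot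
          schur_complement_bordered)
  next
    case False
    then show ?thesis
      using s by (auto simp: Gamma_integrand_def pos_definite_iff_schur_complement pivot
          schur_complement_bordered)
  qed
qed

text \<open>
  Transport along \<open>bordered\<close>, then Fubini with the pivot outermost: the inner integral over \<open>(b, S)\<close>
  is a product for each \<open>c\<close>. The bound on \<open>Re z\<close> is the convergence of the remaining
  Euler integral at \<open>c = 0\<close>.
\<close>

lemma has_bochner_integral_Gamma_integrand_Suc:
  assumes IH: "has_bochner_integral (sym_lborel m) (Gamma_integrand m z) I"
    and z: "Re z > - (real m / 2) - 1"
  shows "has_bochner_integral (sym_lborel (Suc m)) (Gamma_integrand (Suc m) z)
    (of_real (pi powr (real m / 2)) * Gamma (z + of_nat m / 2 + 1) * I)"
proof -
  let ?B = "border_lborel m" and ?S = "sym_lborel m"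
  let ?q = "\<lambda>c b. exp (- (\<Sum>p\<in>border_index m. (b p)\<^sup>2) / c) :: real"
  let ?f = "\<lambda>w. Gamma_integrand (Suc m) z (bordered m w)"
  define h where "h = (\<lambda>c. if c > 0 then complex_of_real (exp (- c)) * of_real c powr z else 0)"
  \<comment> \<open>What remains in the pivot once the Gaussian has been integrated out.\<close>
  define k where "k = (\<lambda>c. h c * of_real (sqrt (pi * c) ^ m))"
  have k: "has_bochner_integral lborel k
      (of_real (pi powr (real m / 2)) * Gamma (z + of_nat m / 2 + 1))"
  proof -
    \<comment> \<open>The \<open>+ 1 - 1\<close> exhibits the Euler integrand with argument \<open>z + m / 2 + 1\<close>.\<close>
    have "k = (\<lambda>c. of_real (pi powr (real m / 2)) * (if c > 0 then
        complex_of_real (exp (- c)) * of_real c powr (z + of_nat m / 2 + 1 - 1) else 0))"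
      by (auto simp: k_def h_def fun_eq_iff mult.assoc of_real_powr_times_sqrt_power simp del: of_real_power)
    then show ?thesis
      using z by (auto intro!: has_bochner_integral_mult_right has_bochner_integral_Gamma)
  qed
  have tail: "sigma_finite_measure (?B \<Otimes>\<^sub>M ?S)"
  proof -
    interpret pair_sigma_finite ?B ?S ..
    show ?thesis by (rule sigma_finite_measure_axioms)
  qed
  have inner: "has_bochner_integral (?B \<Otimes>\<^sub>M ?S)
      (\<lambda>(b, s). h c * (of_real (?q c b) * Gamma_integrand m z s))
      (h c * (of_real (sqrt (pi * c) ^ m) * I))" for c
  proof (cases "c > 0")
    case True
    then show ?thesis
      using has_bochner_integral_mult_right[OF has_bochner_integral_Gaussian_mult[OF True IH]]
      by (simp add: case_prod_unfold)
  qed (simp add: h_def case_prod_unfold has_bochner_integral_zero)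
  have "has_bochner_integral (lborel \<Otimes>\<^sub>M (?B \<Otimes>\<^sub>M ?S)) ?f
      (of_real (pi powr (real m / 2)) * Gamma (z + of_nat m / 2 + 1) * I)"
  proof (rule has_bochner_integral_pair[where g = "\<lambda>c. k c * I" and
        h = "\<lambda>c. norm (k c) * (\<integral>s. norm (Gamma_integrand m z s) \<partial>?S)"])
    have split: "?f (c, y) = (case y of (b, s) \<Rightarrow> h c * (of_real (?q c b) * Gamma_integrand m z s))"
      if "y \<in> space (?B \<Otimes>\<^sub>M ?S)" for c y
      using that by (auto simp: space_pair_measure Gamma_integrand_bordered h_def)
    show "has_bochner_integral (?B \<Otimes>\<^sub>M ?S) (\<lambda>y. ?f (c, y)) (k c * I)" for c
      using inner[of c] split[of _ c]
      by (subst has_bochner_integral_cong[OF refl split refl]) (simp_all add: k_def mult.assoc)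
    let ?N = "\<integral>s. norm (Gamma_integrand m z s) \<partial>?S"
    show "(\<integral>y. norm (?f (c, y)) \<partial>(?B \<Otimes>\<^sub>M ?S)) = norm (k c) * ?N" for c
    proof (cases "c > 0")
      case True
      have "has_bochner_integral ?S (\<lambda>s. norm (Gamma_integrand m z s)) ?N"
        using IH by (auto simp: has_bochner_integral_iff)
      note gauss = has_bochner_integral_Gaussian_mult[OF True this]
      have "(\<integral>y. norm (?f (c, y)) \<partial>(?B \<Otimes>\<^sub>M ?S)) =
          (\<integral>y. norm (h c) * (case y of (b, s) \<Rightarrow> ?q c b * norm (Gamma_integrand m z s)) \<partial>(?B \<Otimes>\<^sub>M ?S))"
        by (intro Bochner_Integration.integral_cong refl)
          (auto simp: split norm_mult simp del: of_real_exp split: prod.splits)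
      also have "\<dots> = norm (h c) * (sqrt (pi * c) ^ m * ?N)"
        using gauss by (simp add: has_bochner_integral_iff)
      finally show ?thesis
        using True by (simp add: k_def norm_mult norm_power)
    next
      case False
      then have "(\<integral>y. norm (?f (c, y)) \<partial>(?B \<Otimes>\<^sub>M ?S)) = (\<integral>y. 0 \<partial>(?B \<Otimes>\<^sub>M ?S))"
        by (intro Bochner_Integration.integral_cong refl)
          (auto simp: split h_def split: prod.splits)
      then show ?thesis
        using False by (simp add: k_def h_def)
    qed
    show "integrable lborel (\<lambda>c. norm (k c) * ?N)"
      using k by (intro integrable_mult_left integrable_norm) (auto simp: has_bochner_integral_iff)
    show "has_bochner_integral lborel (\<lambda>c. k c * I)
        (of_real (pi powr (real m / 2)) * Gamma (z + of_nat m / 2 + 1) * I)"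
      using k by (intro has_bochner_integral_mult_left) auto
  qed (use tail in \<open>auto intro: lborel.sigma_finite_measure_axioms\<close>)
  moreover have "has_bochner_integral (lborel \<Otimes>\<^sub>M (?B \<Otimes>\<^sub>M ?S)) ?f J \<longleftrightarrow>
      has_bochner_integral (sym_lborel (Suc m)) (Gamma_integrand (Suc m) z) J" for J
    using integrable_distr_eq[of "bordered m" "lborel \<Otimes>\<^sub>M (?B \<Otimes>\<^sub>M ?S)" "sym_lborel (Suc m)"
        "Gamma_integrand (Suc m) z"]
      integral_distr[of "bordered m" "lborel \<Otimes>\<^sub>M (?B \<Otimes>\<^sub>M ?S)" "sym_lborel (Suc m)"
        "Gamma_integrand (Suc m) z"]
    by (simp add: distr_bordered has_bochner_integral_iff)
  ultimately show ?thesis by blast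
qed

lemma has_bochner_integral_Gamma_integrand:
  assumes "Re a > (real m - 1) / 2"
  shows "has_bochner_integral (sym_lborel m) (Gamma_integrand m (a - (of_nat m + 1) / 2))
    (of_real (pi powr (real m * (real m - 1) / 4)) * (\<Prod>i=1..m. Gamma (a - (of_nat i - 1) / 2)))"
  using assms
proof (induction m arbitrary: a)
  case 0
  have "pos_definite (sym_mat 0 x)" for x
    by (simp add: pos_definite_sym_mat_iff)
  then have "Gamma_integrand 0 z = (\<lambda>_. 1)" for z
    by (simp add: fun_eq_iff Gamma_integrand_def mat_trace_def sym_mat_def)
  moreover have "sym_lborel 0 = count_space {\<lambda>_. undefined}"
    by (simp add: sym_lborel_def sym_index_def PiM_empty)
  ultimately show ?case
    by (simp add: has_bochner_integral_iff integrable_count_space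
        lebesgue_integral_count_space_finite)
next
  case (Suc m)
  let ?P = "\<lambda>a. \<Prod>i=1..m. Gamma (a - (of_nat i - 1) / 2 :: complex)"
  \<comment> \<open>The exponent for \<open>a\<close> in size \<open>m + 1\<close> is that for \<open>a - 1/2\<close> in size \<open>m\<close>.\<close>
  have exponent: "a - (of_nat (Suc m) + 1) / 2 = (a - 1 / 2) - (of_nat m + 1) / 2"
    by (simp add: field_simps)
  have "has_bochner_integral (sym_lborel (Suc m))
      (Gamma_integrand (Suc m) (a - 1 / 2 - (of_nat m + 1) / 2))
      (of_real (pi powr (real m / 2)) *
        Gamma (a - 1 / 2 - (of_nat m + 1) / 2 + of_nat m / 2 + 1) *
        (of_real (pi powr (real m * (real m - 1) / 4)) * ?P (a - 1 / 2)))"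
    using Suc.prems
    by (intro has_bochner_integral_Gamma_integrand_Suc Suc.IH) (simp_all add: field_simps)
  also have "a - 1 / 2 - (of_nat m + 1) / 2 + of_nat m / 2 + 1 = a"
    by (simp add: field_simps)
  also have "of_real (pi powr (real m / 2)) * Gamma a *
        (of_real (pi powr (real m * (real m - 1) / 4)) * ?P (a - 1 / 2)) =
      of_real (pi powr (real m / 2) * pi powr (real m * (real m - 1) / 4)) *
        (Gamma a * ?P (a - 1 / 2))"
    by simp
  also have "pi powr (real m / 2) * pi powr (real m * (real m - 1) / 4) =
      pi powr (real (Suc m) * (real (Suc m) - 1) / 4)"
    by (simp add: powr_add[symmetric] field_simps)
  also have "Gamma a * ?P (a - 1 / 2) = (\<Prod>i=1..Suc m. Gamma (a - (of_nat i - 1) / 2))"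
  proof -
    have "(\<Prod>i=1..Suc m. Gamma (a - (of_nat i - 1) / 2)) =
        Gamma (a - (of_nat 1 - 1) / 2) * (\<Prod>i=Suc 1..Suc m. Gamma (a - (of_nat i - 1) / 2))"
      by (rule prod.atLeast_Suc_atMost) simp
    also have "(\<Prod>i=Suc 1..Suc m. Gamma (a - (of_nat i - 1) / 2)) =
        (\<Prod>i=1..m. Gamma (a - (of_nat (Suc i) - 1) / 2))"
      by (rule prod.shift_bounds_cl_Suc_ivl)
    also have "(\<Prod>i=1..m. Gamma (a - (of_nat (Suc i) - 1) / 2)) = ?P (a - 1 / 2)"
      by (intro prod.cong refl arg_cong[of _ _ Gamma]) (simp add: field_simps)
    finally show ?thesis by simp
  qed
  finally show ?case
    by (simp only: exponent)
qed

theorem lemma2p1: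
  fixes m :: nat and a :: complex
  assumes "m \<ge> 1"
    and "Re a > (real m - 1) / 2"
  shows "multivariate_Gamma m a =
           of_real (pi powr (real m * (real m - 1) / 4)) *
             (\<Prod>i=1..m. Gamma (a - (of_nat i - 1) / 2)) \<and>
         multivariate_Gamma m a =
           of_real (pi powr (real m * (real m - 1) / 4)) *
             (\<Prod>i=1..m. Gamma (a - (of_nat m - of_nat i) / 2))"
proof -
  have "multivariate_Gamma m a = of_real (pi powr (real m * (real m - 1) / 4)) *
      (\<Prod>i=1..m. Gamma (a - (of_nat i - 1) / 2))"
    using has_bochner_integral_Gamma_integrand[OF assms(2)]
    by (simp add: multivariate_Gamma_eq has_bochner_integral_iff)
  moreover have "(\<Prod>i=1..m. Gamma (a - (of_nat i - 1) / 2)) =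
      (\<Prod>i=1..m. Gamma (a - (of_nat m - of_nat i) / 2))"
    by (subst prod.atLeastAtMost_rev) (auto intro!: prod.cong simp: of_nat_diff)
  ultimately show ?thesis by simp
qed

end
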